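(* Let $|\psi\rangle\in\mathcal{H}$ be a normalized pure state that is UDA relative to a non-trivial neighborhood structure $\mathcal{N}=\{\mathcal{N}_k\}$, and write $\rho=|\psi\rangle\langle\psi|$. Consider the optimization problem: maximize $-\mathrm{tr}(H\rho)$ over Hermitian operators $H$ on $\mathcal{H}$ subject to (i) $H+\rho\ge0$ and (ii) $H$ is quasi-local relative to $\mathcal{N}$, i.e. $H=\sum_k H_{\mathcal{N}_k}\otimes I_{\overline{\mathcal{N}}_k}$ for some operators $H_{\mathcal{N}_k}$ on $\bigotimes_{a\in\mathcal{N}_k}\mathcal{H}_a$. Assume this problem attains its optimal value, i.e. some feasible $H$ achieves the supremum. Then there exists a Hamiltonian that is quasi-local relative to $\mathcal{N}$ and has $|\psi\rangle$ as its unique ground state.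
   Context: $\mathcal{H}=\bigotimes_{a=1}^N\mathcal{H}_a$ is finite-dimensional; $\mathcal{D}(\mathcal{H})$ is the set of density operators. A neighborhood is $\mathcal{N}_k\subsetneq\{1,\dots,N\}$ with complement $\overline{\mathcal{N}}_k$; a neighborhood structure is a finite collection of neighborhoods, non-trivial if every index lies in some neighborhood and each neighborhood intersects another. $\rho_{\mathcal{N}_k}=\mathrm{tr}_{\overline{\mathcal{N}}_k}\rho$. A state $\rho$ is UDA relative to $\mathcal{N}$ if no $\sigma\in\mathcal{D}(\mathcal{H})$, $\sigma\neq\rho$, has $\sigma_{\mathcal{N}_k}=\rho_{\mathcal{N}_k}$ for all $k$. A Hamiltonian is quasi-local relative to $\mathcal{N}$ if it is Hermitian of the form $\sum_kH_{\mathcal{N}_k}\otimes I_{\overline{\mathcal{N}}_k}$; $|\psi\rangle$ is its unique ground state if the eigenspace of the smallest eigenvalue is $\mathrm{span}\{|\psi\rangle\}$. *)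

theory Defs
  imports Complex_Main
begin

text \<open>
  The system is H = tensor product of H_a, a = 1..N, with dim H_a = d a.
  A computational basis vector of the subsystem S (a subset of {1..N}) is a
  configuration i :: nat => nat with i a < d a for a in S and i a = 0 outside S.
  Operators on the subsystem S are matrices indexed by such configurations,
  represented as functions (only their values on configurations of S matter);
  vectors likewise.
\<close>

type_synonym config = "nat \<Rightarrow> nat"
type_synonym vec = "config \<Rightarrow> complex"
type_synonym op = "config \<Rightarrow> config \<Rightarrow> complex"

definition cfg :: "(nat \<Rightarrow> nat) \<Rightarrow> nat set \<Rightarrow> config set" where
  "cfg d S = {i. (\<forall>a\<in>S. i a < d a) \<and> (\<forall>a. a \<notin> S \<longrightarrow> i a = 0)}"

definition sites :: "nat \<Rightarrow> nat set" where
  "sites N = {1..N}"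

definition restr :: "nat set \<Rightarrow> config \<Rightarrow> config" where
  "restr S i = (\<lambda>a. if a \<in> S then i a else 0)"

definition merge :: "nat set \<Rightarrow> config \<Rightarrow> config \<Rightarrow> config" where
  "merge S i k = (\<lambda>a. if a \<in> S then i a else k a)"

definition op_apply :: "(nat \<Rightarrow> nat) \<Rightarrow> nat \<Rightarrow> op \<Rightarrow> vec \<Rightarrow> vec" where
  "op_apply d N A v = (\<lambda>i. \<Sum>j\<in>cfg d (sites N). A i j * v j)"

definition hermitian_op :: "(nat \<Rightarrow> nat) \<Rightarrow> nat set \<Rightarrow> op \<Rightarrow> bool" where
  "hermitian_op d S A \<longleftrightarrow> (\<forall>i\<in>cfg d S. \<forall>j\<in>cfg d S. A j i = cnj (A i j))"

definition psd_op :: "(nat \<Rightarrow> nat) \<Rightarrow> nat set \<Rightarrow> op \<Rightarrow> bool" where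
  "psd_op d S A \<longleftrightarrow> (\<forall>v :: vec.
     let q = (\<Sum>i\<in>cfg d S. \<Sum>j\<in>cfg d S. cnj (v i) * A i j * v j) in Im q = 0 \<and> Re q \<ge> 0)"

definition op_trace :: "(nat \<Rightarrow> nat) \<Rightarrow> nat set \<Rightarrow> op \<Rightarrow> complex" where
  "op_trace d S A = (\<Sum>i\<in>cfg d S. A i i)"

definition op_mult :: "(nat \<Rightarrow> nat) \<Rightarrow> nat set \<Rightarrow> op \<Rightarrow> op \<Rightarrow> op" where
  "op_mult d S A B = (\<lambda>i k. \<Sum>j\<in>cfg d S. A i j * B j k)"

definition density :: "(nat \<Rightarrow> nat) \<Rightarrow> nat \<Rightarrow> op \<Rightarrow> bool" where
  "density d N \<sigma> \<longleftrightarrow> hermitian_op d (sites N) \<sigma> \<and> psd_op d (sites N) \<sigma>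
      \<and> op_trace d (sites N) \<sigma> = 1"

definition ptrace :: "(nat \<Rightarrow> nat) \<Rightarrow> nat \<Rightarrow> nat set \<Rightarrow> op \<Rightarrow> op" where
  "ptrace d N S \<rho> = (\<lambda>i j. \<Sum>k\<in>cfg d (sites N - S). \<rho> (merge S i k) (merge S j k))"

definition embed :: "nat \<Rightarrow> nat set \<Rightarrow> op \<Rightarrow> op" where
  "embed N S A = (\<lambda>i j. A (restr S i) (restr S j) *
      (if restr (sites N - S) i = restr (sites N - S) j then 1 else 0))"

definition nontrivial_nbhd :: "nat \<Rightarrow> nat set set \<Rightarrow> bool" where
  "nontrivial_nbhd N NS \<longleftrightarrow> finite NS \<and> (\<forall>S\<in>NS. S \<subset> sites N)
     \<and> (\<forall>a\<in>sites N. \<exists>S\<in>NS. a \<in> S)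
     \<and> (\<forall>S\<in>NS. \<exists>T\<in>NS. T \<noteq> S \<and> S \<inter> T \<noteq> {})"

definition UDA :: "(nat \<Rightarrow> nat) \<Rightarrow> nat \<Rightarrow> nat set set \<Rightarrow> op \<Rightarrow> bool" where
  "UDA d N NS \<rho> \<longleftrightarrow> (\<forall>\<sigma>. density d N \<sigma> \<and>
      (\<forall>S\<in>NS. \<forall>i\<in>cfg d S. \<forall>j\<in>cfg d S. ptrace d N S \<sigma> i j = ptrace d N S \<rho> i j)
      \<longrightarrow> (\<forall>i\<in>cfg d (sites N). \<forall>j\<in>cfg d (sites N). \<sigma> i j = \<rho> i j))"

definition quasi_local :: "(nat \<Rightarrow> nat) \<Rightarrow> nat \<Rightarrow> nat set set \<Rightarrow> op \<Rightarrow> bool" where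
  "quasi_local d N NS H \<longleftrightarrow> hermitian_op d (sites N) H \<and>
     (\<exists>HL :: nat set \<Rightarrow> op. \<forall>i\<in>cfg d (sites N). \<forall>j\<in>cfg d (sites N).
        H i j = (\<Sum>S\<in>NS. embed N S (HL S) i j))"

definition eigenvalue_op :: "(nat \<Rightarrow> nat) \<Rightarrow> nat \<Rightarrow> op \<Rightarrow> complex \<Rightarrow> bool" where
  "eigenvalue_op d N H lam \<longleftrightarrow> (\<exists>v. (\<exists>i\<in>cfg d (sites N). v i \<noteq> 0) \<and>
      (\<forall>i\<in>cfg d (sites N). op_apply d N H v i = lam * v i))"

definition unique_ground_state :: "(nat \<Rightarrow> nat) \<Rightarrow> nat \<Rightarrow> op \<Rightarrow> vec \<Rightarrow> bool" where
  "unique_ground_state d N H \<psi> \<longleftrightarrow> (\<exists>lam. eigenvalue_op d N H lam \<and>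
      (\<forall>\<mu>. eigenvalue_op d N H \<mu> \<longrightarrow> Re lam \<le> Re \<mu>) \<and>
      (\<forall>v. (\<forall>i\<in>cfg d (sites N). op_apply d N H v i = lam * v i)
            \<longleftrightarrow> (\<exists>c. \<forall>i\<in>cfg d (sites N). v i = c * \<psi> i)))"

definition proj :: "vec \<Rightarrow> op" where
  "proj \<psi> = (\<lambda>i j. \<psi> i * cnj (\<psi> j))"

definition normalized :: "(nat \<Rightarrow> nat) \<Rightarrow> nat \<Rightarrow> vec \<Rightarrow> bool" where
  "normalized d N \<psi> \<longleftrightarrow> (\<Sum>i\<in>cfg d (sites N). (cmod (\<psi> i))\<^sup>2) = 1"

definition sdp_feasible :: "(nat \<Rightarrow> nat) \<Rightarrow> nat \<Rightarrow> nat set set \<Rightarrow> op \<Rightarrow> op \<Rightarrow> bool" where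
  "sdp_feasible d N NS \<rho> H \<longleftrightarrow> hermitian_op d (sites N) H
     \<and> psd_op d (sites N) (\<lambda>i j. H i j + \<rho> i j) \<and> quasi_local d N NS H"

definition sdp_objective :: "(nat \<Rightarrow> nat) \<Rightarrow> nat \<Rightarrow> op \<Rightarrow> op \<Rightarrow> real" where
  "sdp_objective d N \<rho> H = - Re (op_trace d (sites N) (op_mult d (sites N) H \<rho>))"

end

theory Submission
  imports "HOL-Analysis.Function_Topology" "HOL-Analysis.Topology_Euclidean_Space" Defs
begin

text \<open>
  Weak duality bounds the objective by \<open>1\<close>, and the dual problem is feasible only at
  density operators with the marginals of \<open>\<rho>\<close>, i.e. by UDA only at \<open>\<rho>\<close> itself. That there is no
  duality gap is shown by hand: for \<open>\<epsilon> > 0\<close> let \<open>\<tau>\<close> minimise, over the compact convex set of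
  density operators \<open>\<sigma>\<close>, the squared distance of (marginals of \<open>\<sigma>\<close>, \<open>tr (\<rho> \<sigma>)\<close>) from
  (marginals of \<open>\<rho>\<close>, \<open>1 - \<epsilon>\<close>). By UDA this distance is positive, and its first-order optimality
  condition at \<open>\<tau>\<close> is a separating hyperplane whose normal vector is, after rescaling and a shift
  by a multiple of the identity, a feasible \<open>H\<close> with objective \<open>1 - \<epsilon>\<close>. Hence an optimal \<open>H\<close>
  has \<open>\<langle>\<psi>|H + \<rho>|\<psi>\<rangle> = 0\<close>, so \<open>\<psi>\<close> lies in the kernel of \<open>H + \<rho> \<ge> 0\<close>, i.e. \<open>H \<psi> = - \<psi>\<close>,
  while \<open>H \<ge> 0\<close> on the orthogonal complement of \<open>\<psi>\<close>.
\<close>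

section \<open>Configurations and traces\<close>

abbreviation trace_pair :: "(nat \<Rightarrow> nat) \<Rightarrow> nat \<Rightarrow> op \<Rightarrow> op \<Rightarrow> complex" where
  "trace_pair d N A B \<equiv> op_trace d (sites N) (op_mult d (sites N) A B)"

definition qform :: "(nat \<Rightarrow> nat) \<Rightarrow> nat \<Rightarrow> op \<Rightarrow> vec \<Rightarrow> complex" where
  "qform d N A v = (\<Sum>i\<in>cfg d (sites N). \<Sum>j\<in>cfg d (sites N). cnj (v i) * A i j * v j)"

lemma finite_cfg:
  assumes "finite S"
  shows "finite (cfg d S)"
proof -
  have "finite {f. \<forall>x. (x \<in> S \<longrightarrow> f x \<in> (\<Union>a\<in>S. {..<d a})) \<and> (x \<notin> S \<longrightarrow> f x = 0)}"
    using assms by (intro finite_set_of_finite_funs) auto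
  then show ?thesis
    by (rule rev_finite_subset) (auto simp: cfg_def)
qed

lemma finite_cfg_sites [simp]: "finite (cfg d (sites N))"
  by (simp add: finite_cfg sites_def)

lemma merge_in_cfg:
  assumes "S \<subseteq> sites N" "s \<in> cfg d S" "k \<in> cfg d (sites N - S)"
  shows "merge S s k \<in> cfg d (sites N)"
  using assms by (auto simp: cfg_def merge_def)

lemma restr_merge:
  assumes "s \<in> cfg d S" "k \<in> cfg d (sites N - S)"
  shows "restr S (merge S s k) = s" "restr (sites N - S) (merge S s k) = k"
  using assms by (auto simp: cfg_def merge_def restr_def fun_eq_iff)

text \<open>The factorisation of the space into \<open>S\<close> and its complement, on the level of
  basis vectors: splitting and merging configurations are mutually inverse.\<close>

lemma sum_cfg_merge:
  fixes f :: "config \<Rightarrow> 'a::comm_monoid_add"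
  assumes "S \<subseteq> sites N"
  shows "(\<Sum>i\<in>cfg d (sites N). f i) =
    (\<Sum>s\<in>cfg d S. \<Sum>k\<in>cfg d (sites N - S). f (merge S s k))"
proof -
  have *: "merge S (restr S i) (restr (sites N - S) i) = i" if "i \<in> cfg d (sites N)" for i
    using that by (auto simp: cfg_def merge_def restr_def fun_eq_iff)
  show ?thesis
    unfolding sum.cartesian_product using assms
    by (intro sum.reindex_bij_witness[where j = "\<lambda>i. (restr S i, restr (sites N - S) i)"
          and i = "\<lambda>(s, k). merge S s k"])
      (auto simp: * restr_merge merge_in_cfg, auto simp: cfg_def restr_def)
qed

text \<open>Embedding is dual to the partial trace. The identity factor forces the two outer indices
  to agree, and the remaining sum over them is \<open>ptrace\<close>. Hence quasi-local operators
  see a state only through its marginals.\<close>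

lemma trace_pair_embed:
  assumes "S \<subseteq> sites N"
  shows "trace_pair d N (embed N S X) \<sigma> =
    (\<Sum>i\<in>cfg d S. \<Sum>j\<in>cfg d S. X i j * ptrace d N S \<sigma> j i)"
proof -
  let ?S = "cfg d S" and ?T = "cfg d (sites N - S)"
  have fin: "finite ?T" by (simp add: finite_cfg sites_def)
  have "trace_pair d N (embed N S X) \<sigma> =
     (\<Sum>i\<in>?S. \<Sum>k\<in>?T. \<Sum>j\<in>?S. \<Sum>l\<in>?T.
        embed N S X (merge S i k) (merge S j l) * \<sigma> (merge S j l) (merge S i k))"
    by (simp add: op_trace_def op_mult_def sum_cfg_merge[OF assms])
  also have "\<dots> = (\<Sum>i\<in>?S. \<Sum>k\<in>?T. \<Sum>j\<in>?S. \<Sum>l\<in>?T.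
        if k = l then X i j * \<sigma> (merge S j l) (merge S i k) else 0)"
    by (intro sum.cong refl) (auto simp: embed_def restr_merge)
  also have "\<dots> = (\<Sum>i\<in>?S. \<Sum>k\<in>?T. \<Sum>j\<in>?S. X i j * \<sigma> (merge S j k) (merge S i k))"
    using fin by (simp add: sum.delta)
  also have "\<dots> = (\<Sum>i\<in>?S. \<Sum>j\<in>?S. \<Sum>k\<in>?T. X i j * \<sigma> (merge S j k) (merge S i k))"
    by (subst sum.swap) simp
  finally show ?thesis
    by (simp add: ptrace_def sum_distrib_left)
qed

text \<open>This links inequalities over states to positivity of operators.\<close>

lemma trace_pair_proj: "trace_pair d N A (proj v) = qform d N A v"
  by (simp add: op_trace_def op_mult_def qform_def proj_def mult_ac)

lemma psd_op_qform:
  "psd_op d (sites N) A \<longleftrightarrow> (\<forall>v. Im (qform d N A v) = 0 \<and> Re (qform d N A v) \<ge> 0)"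
  by (simp add: psd_op_def qform_def Let_def)

lemma qform_add: "qform d N (\<lambda>i j. A i j + B i j) v = qform d N A v + qform d N B v"
  by (simp add: qform_def algebra_simps sum.distrib)

lemma qform_scale: "qform d N (\<lambda>i j. c * A i j) v = c * qform d N A v"
  by (simp add: qform_def algebra_simps sum_distrib_left)

lemma qform_scale_vec: "qform d N A (\<lambda>i. c * v i) = (cmod c)\<^sup>2 * qform d N A v"
  by (simp add: qform_def sum_distrib_left complex_norm_square mult_ac del: of_real_power)

lemma qform_cong:
  assumes "\<And>i. i \<in> cfg d (sites N) \<Longrightarrow> v i = w i"
  shows "qform d N A v = qform d N A w"
  using assms by (simp add: qform_def)

lemma qform_proj:
  "qform d N (proj \<psi>) v = (cmod (\<Sum>i\<in>cfg d (sites N). cnj (\<psi> i) * v i))\<^sup>2"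
  unfolding complex_norm_square
  by (simp add: qform_def proj_def sum_product mult_ac)

lemma hermitian_opD:
  assumes "hermitian_op d S A" "i \<in> cfg d S" "j \<in> cfg d S"
  shows "cnj (A i j) = A j i"
  using assms unfolding hermitian_op_def by metis

lemma qform_hermitian_real:
  assumes "hermitian_op d (sites N) A"
  shows "Im (qform d N A v) = 0"
proof -
  have "cnj (qform d N A v) =
      (\<Sum>i\<in>cfg d (sites N). \<Sum>j\<in>cfg d (sites N). cnj (v j) * A j i * v i)"
    by (simp add: qform_def hermitian_opD[OF assms] mult_ac)
  also have "\<dots> = qform d N A v"
    unfolding qform_def by (rule sum.swap)
  finally have "Im (cnj (qform d N A v)) = Im (qform d N A v)"
    by (rule arg_cong)
  then show ?thesis by simp
qed

section \<open>Density operators\<close>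

lemma density_proj:
  assumes "normalized d N v"
  shows "density d N (proj v)"
proof -
  have "op_trace d (sites N) (proj v) = of_real (\<Sum>i\<in>cfg d (sites N). (cmod (v i))\<^sup>2)"
    unfolding of_real_sum
    by (simp add: op_trace_def proj_def complex_norm_square del: of_real_power)
  then have "op_trace d (sites N) (proj v) = 1"
    using assms by (simp add: normalized_def del: of_real_sum)
  moreover have "hermitian_op d (sites N) (proj v)"
    by (simp add: hermitian_op_def proj_def)
  ultimately show ?thesis
    by (simp add: density_def psd_op_qform qform_proj)
qed

definition mix :: "real \<Rightarrow> op \<Rightarrow> op \<Rightarrow> op" where
  "mix t \<sigma> \<tau> = (\<lambda>i j. of_real (1 - t) * \<sigma> i j + of_real t * \<tau> i j)"

lemma density_mix:
  assumes "density d N \<sigma>" "density d N \<tau>" "0 \<le> t" "t \<le> 1"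
  shows "density d N (mix t \<sigma> \<tau>)"
proof -
  have "op_trace d (sites N) (mix t \<sigma> \<tau>) =
      of_real (1 - t) * op_trace d (sites N) \<sigma> + of_real t * op_trace d (sites N) \<tau>"
    by (simp add: op_trace_def mix_def sum.distrib sum_distrib_left)
  moreover have "hermitian_op d (sites N) (mix t \<sigma> \<tau>)"
    using assms unfolding density_def
    by (subst hermitian_op_def) (simp add: mix_def hermitian_opD[of d "sites N"] del: of_real_diff)
  moreover have "qform d N (mix t \<sigma> \<tau>) v =
      of_real (1 - t) * qform d N \<sigma> v + of_real t * qform d N \<tau> v" for v
    unfolding mix_def qform_add qform_scale ..
  ultimately show ?thesis
    using assms by (simp add: density_def psd_op_qform)
qed

lemma ptrace_mix:
  "ptrace d N S (mix t \<sigma> \<tau>) i j =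
    of_real (1 - t) * ptrace d N S \<sigma> i j + of_real t * ptrace d N S \<tau> i j"
  by (simp add: ptrace_def mix_def sum.distrib sum_distrib_left)

lemma trace_pair_mix:
  "trace_pair d N A (mix t \<sigma> \<tau>) =
    of_real (1 - t) * trace_pair d N A \<sigma> + of_real t * trace_pair d N A \<tau>"
  by (simp add: op_trace_def op_mult_def mix_def sum.distrib sum_distrib_left distrib_left
      mult.left_commute del: of_real_diff)

lemma hermitian_ptrace:
  assumes "hermitian_op d (sites N) \<sigma>" "S \<subseteq> sites N"
  shows "hermitian_op d S (ptrace d N S \<sigma>)"
  unfolding hermitian_op_def using assms by (simp add: ptrace_def hermitian_opD[of d "sites N"] merge_in_cfg)

text \<open>Only the entries on configurations of the system are relevant; bounding all entries
  makes the set of density operators compact in the product topology.\<close>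

definition bounded_densities :: "(nat \<Rightarrow> nat) \<Rightarrow> nat \<Rightarrow> op set" where
  "bounded_densities d N = {\<sigma>. density d N \<sigma> \<and> (\<forall>i j. cmod (\<sigma> i j) \<le> 1)}"

text \<open>Tychonoff's theorem; the index type may be infinite, as the type of all configurations
  is.\<close>

lemma compact_PiE_UNIV:
  fixes B :: "'a \<Rightarrow> 'b::topological_space set"
  assumes "\<And>i. compact (B i)"
  shows "compact (PiE UNIV B)"
  using assms compactin_PiE[of "\<lambda>_. euclidean :: 'b topology" UNIV B]
  by (simp add: euclidean_product_topology)

lemma continuous_on_entry [continuous_intros]:
  "continuous_on X (\<lambda>\<sigma> :: 'a \<Rightarrow> 'b \<Rightarrow> 'c::topological_space. \<sigma> i j)"
proof -
  have "continuous_on UNIV (\<lambda>\<sigma> :: 'a \<Rightarrow> 'b \<Rightarrow> 'c. \<sigma> i)"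
    by (rule continuous_on_product_coordinates)
  then have "continuous_on UNIV (\<lambda>\<sigma> :: 'a \<Rightarrow> 'b \<Rightarrow> 'c. \<sigma> i j)"
    by (rule continuous_on_product_then_coordinatewise)
  then show ?thesis
    by (rule continuous_on_subset) simp
qed

lemma compact_bounded_densities: "compact (bounded_densities d N)"
proof -
  let ?B = "PiE UNIV (\<lambda>_::config. PiE UNIV (\<lambda>_::config. cball (0::complex) 1))"
  have "compact ?B"
    by (intro compact_PiE_UNIV compact_cball)
  \<comment> \<open>Each requirement is an equation or a weak inequality, for fixed indices or a
    fixed test vector, between continuous functions of finitely many entries.\<close>
  moreover have "closed {\<sigma>. density d N \<sigma>}"
    unfolding density_def hermitian_op_def psd_op_qform qform_def op_trace_def Ball_def
    by (intro closed_Collect_conj closed_Collect_all closed_Collect_imp closed_Collect_eq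
        closed_Collect_le open_Collect_const continuous_intros)
  moreover have "bounded_densities d N = ?B \<inter> {\<sigma>. density d N \<sigma>}"
    by (auto simp: bounded_densities_def PiE_def Pi_def extensional_def)
  ultimately show ?thesis
    by (simp add: compact_Int_closed)
qed

text \<open>Normalisation controls only the values on the system, so those outside must be set to
  zero for all entries to be bounded.\<close>

lemma proj_in_bounded_densities:
  assumes "normalized d N v" "\<And>i. i \<notin> cfg d (sites N) \<Longrightarrow> v i = 0"
  shows "proj v \<in> bounded_densities d N"
proof -
  have "cmod (v i) \<le> 1" for i
  proof (cases "i \<in> cfg d (sites N)")
    case True
    then have "(cmod (v i))\<^sup>2 \<le> (\<Sum>i\<in>cfg d (sites N). (cmod (v i))\<^sup>2)"
      by (intro member_le_sum) auto
    then show ?thesis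
      using assms(1) by (simp add: normalized_def power_le_one_iff)
  qed (simp add: assms)
  then show ?thesis
    using density_proj[OF assms(1)]
    by (auto simp: bounded_densities_def proj_def norm_mult intro: mult_le_one)
qed

lemma mix_in_bounded_densities:
  assumes "\<sigma> \<in> bounded_densities d N" "\<tau> \<in> bounded_densities d N" "0 \<le> t" "t \<le> 1"
  shows "mix t \<sigma> \<tau> \<in> bounded_densities d N"
proof -
  have "cmod (mix t \<sigma> \<tau> i j) \<le> 1" for i j
  proof -
    have "cmod (mix t \<sigma> \<tau> i j) \<le> (1 - t) * cmod (\<sigma> i j) + t * cmod (\<tau> i j)"
      unfolding mix_def using assms(3,4)
      by (intro order.trans[OF norm_triangle_ineq]) (simp add: norm_mult del: of_real_diff)
    also have "\<dots> \<le> 1"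
      using assms by (intro convex_bound_le) (auto simp: bounded_densities_def)
    finally show ?thesis .
  qed
  then show ?thesis
    using assms by (auto simp: bounded_densities_def density_mix)
qed

section \<open>Quasi-local operators\<close>

lemma trace_pair_add:
  "trace_pair d N (\<lambda>i j. A i j + B i j) \<sigma> = trace_pair d N A \<sigma> + trace_pair d N B \<sigma>"
  by (simp add: op_trace_def op_mult_def algebra_simps sum.distrib)

lemma trace_pair_scale:
  "trace_pair d N (\<lambda>i j. c * A i j) \<sigma> = c * trace_pair d N A \<sigma>"
  by (simp add: op_trace_def op_mult_def algebra_simps sum_distrib_left)

lemma trace_pair_sum:
  "trace_pair d N (\<lambda>i j. \<Sum>s\<in>I. A s i j) \<sigma> = (\<Sum>s\<in>I. trace_pair d N (A s) \<sigma>)"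
  by (induction I rule: infinite_finite_induct)
    (simp_all add: trace_pair_add, simp_all add: op_trace_def op_mult_def)

lemma trace_pair_id:
  "trace_pair d N (\<lambda>i j. if i = j then 1 else 0) \<sigma> = op_trace d (sites N) \<sigma>"
  by (simp add: op_trace_def op_mult_def if_distrib[of "\<lambda>x. x * _"] cong: if_cong)

lemma quasi_local_add:
  assumes "quasi_local d N NS A" "quasi_local d N NS B"
  shows "quasi_local d N NS (\<lambda>i j. A i j + B i j)"
proof -
  have "hermitian_op d (sites N) (\<lambda>i j. A i j + B i j)"
    using assms unfolding quasi_local_def
    by (subst hermitian_op_def) (simp add: hermitian_opD[of d "sites N"])
  moreover obtain AL BL where
    "\<forall>i\<in>cfg d (sites N). \<forall>j\<in>cfg d (sites N). A i j = (\<Sum>S\<in>NS. embed N S (AL S) i j)"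
    "\<forall>i\<in>cfg d (sites N). \<forall>j\<in>cfg d (sites N). B i j = (\<Sum>S\<in>NS. embed N S (BL S) i j)"
    using assms unfolding quasi_local_def by blast
  ultimately show ?thesis
    unfolding quasi_local_def
    by (intro conjI exI[of _ "\<lambda>S i j. AL S i j + BL S i j"])
      (simp_all add: embed_def distrib_right sum.distrib)
qed

lemma quasi_local_scale:
  assumes "quasi_local d N NS A"
  shows "quasi_local d N NS (\<lambda>i j. of_real c * A i j)"
proof -
  have "hermitian_op d (sites N) (\<lambda>i j. of_real c * A i j)"
    using assms unfolding quasi_local_def
    by (subst hermitian_op_def) (simp add: hermitian_opD[of d "sites N"])
  moreover obtain AL where
    "\<forall>i\<in>cfg d (sites N). \<forall>j\<in>cfg d (sites N). A i j = (\<Sum>S\<in>NS. embed N S (AL S) i j)"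
    using assms unfolding quasi_local_def by blast
  ultimately show ?thesis
    unfolding quasi_local_def
    by (intro conjI exI[of _ "\<lambda>S i j. of_real c * AL S i j"])
      (simp_all add: embed_def sum_distrib_left mult.assoc)
qed

lemma quasi_local_id:
  assumes "finite NS" "S \<in> NS"
  shows "quasi_local d N NS (\<lambda>i j. if i = j then 1 else 0)"
proof -
  \<comment> \<open>The whole identity is attributed to the single neighborhood \<open>S\<close>;
    every other neighborhood contributes zero.\<close>
  let ?X = "\<lambda>T i j. if T = S \<and> i = j then 1 else 0 :: complex"
  have "embed N T (?X T) i j = (if T = S then if i = j then 1 else 0 else 0)"
    if "i \<in> cfg d (sites N)" "j \<in> cfg d (sites N)" for i j T
  proof -
    have "i = j" if "restr S i = restr S j" "restr (sites N - S) i = restr (sites N - S) j"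
    proof
      fix a
      show "i a = j a"
        using fun_cong[OF that(1), of a] fun_cong[OF that(2), of a]
          \<open>i \<in> cfg d (sites N)\<close> \<open>j \<in> cfg d (sites N)\<close>
        by (auto simp: restr_def cfg_def split: if_splits)
    qed
    then show ?thesis by (auto simp: embed_def)
  qed
  then show ?thesis
    using assms unfolding quasi_local_def
    by (intro conjI exI[of _ ?X]) (auto simp: hermitian_op_def)
qed

lemma quasi_local_sum_embed:
  assumes "\<And>S. S \<in> NS \<Longrightarrow> hermitian_op d S (X S)"
    and "\<And>S. S \<in> NS \<Longrightarrow> S \<subseteq> sites N"
  shows "quasi_local d N NS (\<lambda>i j. \<Sum>S\<in>NS. embed N S (X S) i j)"
proof -
  have restr: "restr S i \<in> cfg d S" if "S \<in> NS" "i \<in> cfg d (sites N)" for S i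
    using that assms(2)[of S] by (auto simp: cfg_def restr_def)
  have "cnj (embed N S (X S) j i) = embed N S (X S) i j"
    if "S \<in> NS" "i \<in> cfg d (sites N)" "j \<in> cfg d (sites N)" for S i j
    using hermitian_opD[OF assms(1)[OF that(1)] restr[OF that(1,3)] restr[OF that(1,2)]]
    by (auto simp: embed_def)
  then have "hermitian_op d (sites N) (\<lambda>i j. \<Sum>S\<in>NS. embed N S (X S) i j)"
    by (simp add: hermitian_op_def)
  then show ?thesis
    unfolding quasi_local_def by (intro conjI exI[of _ X]) simp_all
qed

section \<open>First-order optimality\<close>

text \<open>For small \<open>t\<close> the linear term dominates the quadratic one, so a negative
  slope would be visible.\<close>

lemma nonneg_of_quadratic_nonneg:
  fixes b e :: real
  assumes "\<And>t. 0 < t \<Longrightarrow> t \<le> 1 \<Longrightarrow> 0 \<le> 2 * t * b + t\<^sup>2 * e"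
  shows "0 \<le> b"
proof (rule ccontr)
  assume "\<not> 0 \<le> b"
  \<comment> \<open>With this \<open>t\<close>, a negative \<open>b\<close> gives
    \<open>2 * b + t * e \<le> b < 0\<close>. The \<open>+ 1\<close> keeps the denominator positive
    and the minimum keeps \<open>t\<close> in the admissible range.\<close>
  define t where "t = min 1 (- b / (\<bar>e\<bar> + 1))"
  have t: "0 < t" "t \<le> 1" "t \<le> - b / (\<bar>e\<bar> + 1)"
    using \<open>\<not> 0 \<le> b\<close> by (auto simp: t_def field_simps)
  have "t * (\<bar>e\<bar> + 1) \<le> - b"
    using t(3) by (subst (asm) pos_le_divide_eq) auto
  moreover have "t * e \<le> t * (\<bar>e\<bar> + 1)"
    using t(1) by (intro mult_left_mono) auto
  moreover have "0 \<le> t * (2 * b + t * e)"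
    using assms[OF t(1,2)] by (simp add: power2_eq_square algebra_simps)
  then have "0 \<le> 2 * b + t * e"
    using t(1) by (simp add: zero_le_mult_iff)
  ultimately show False
    using \<open>\<not> 0 \<le> b\<close> by linarith
qed

text \<open>Expansion of the squared modulus of \<open>y + t * (z - y)\<close>; the linear
  coefficient is twice the real inner product of \<open>y\<close> with \<open>z - y\<close>.\<close>

lemma cmod_convex_combination_power2:
  fixes y z :: complex and t :: real
  shows "(cmod (of_real (1 - t) * y + of_real t * z))\<^sup>2 =
    (cmod y)\<^sup>2 + 2 * t * (Re (cnj y * z) - (cmod y)\<^sup>2) + t\<^sup>2 * (cmod (z - y))\<^sup>2"
  by (simp add: cmod_power2) (simp add: power2_eq_square algebra_simps)

text \<open>If \<open>(y, r)\<close> is at least as close to the origin as every point of the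
  segment towards \<open>(z, s)\<close>, the derivative of the squared norm at its start is
  nonnegative. The real coordinate is kept apart because it will carry the objective.\<close>

lemma nearest_point_first_order:
  fixes y z :: "'e \<Rightarrow> complex" and r s :: real
  assumes "\<And>t. 0 < t \<Longrightarrow> t \<le> 1 \<Longrightarrow>
      (\<Sum>e\<in>E. (cmod (y e))\<^sup>2) + r\<^sup>2 \<le>
      (\<Sum>e\<in>E. (cmod (of_real (1 - t) * y e + of_real t * z e))\<^sup>2) + ((1 - t) * r + t * s)\<^sup>2"
  shows "(\<Sum>e\<in>E. (cmod (y e))\<^sup>2) + r\<^sup>2 \<le> Re (\<Sum>e\<in>E. cnj (y e) * z e) + r * s"
proof -
  have "0 \<le> 2 * t * ((\<Sum>e\<in>E. Re (cnj (y e) * z e) - (cmod (y e))\<^sup>2) + (r * s - r\<^sup>2))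
      + t\<^sup>2 * ((\<Sum>e\<in>E. (cmod (z e - y e))\<^sup>2) + (s - r)\<^sup>2)"
    if "0 < t" "t \<le> 1" for t
  proof -
    have "((1 - t) * r + t * s)\<^sup>2 = r\<^sup>2 + 2 * t * (r * s - r\<^sup>2) + t\<^sup>2 * (s - r)\<^sup>2"
      by (simp add: power2_eq_square algebra_simps)
    then show ?thesis
      using assms[OF that]
      unfolding cmod_convex_combination_power2 sum.distrib sum_distrib_left[symmetric]
      by (simp only: distrib_left)
  qed
  then have "0 \<le> (\<Sum>e\<in>E. Re (cnj (y e) * z e) - (cmod (y e))\<^sup>2) + (r * s - r\<^sup>2)"
    by (rule nonneg_of_quadratic_nonneg)
  then show ?thesis
    by (simp add: sum_subtractf)
qed

text \<open>Moving from \<open>v\<close> in direction \<open>- A v\<close> changes the form at first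
  order by \<open>- 2 * t\<close> times the squared norm of \<open>A v\<close>. As the form starts
  at most at zero and may not become negative, that norm vanishes.\<close>

lemma psd_kernel:
  assumes "hermitian_op d (sites N) A" "psd_op d (sites N) A" "Re (qform d N A v) \<le> 0"
    and "i \<in> cfg d (sites N)"
  shows "op_apply d N A v i = 0"
proof -
  let ?C = "cfg d (sites N)"
  define w where "w = op_apply d N A v"
  define n where "n = (\<Sum>i\<in>?C. (cmod (w i))\<^sup>2)"
  let ?P = "\<Sum>i\<in>?C. \<Sum>j\<in>?C. cnj (w i) * A i j * v j"
  let ?Q = "\<Sum>i\<in>?C. \<Sum>j\<in>?C. cnj (v i) * A i j * w j"
  have P: "?P = of_real n"
    unfolding n_def of_real_sum complex_norm_square
  proof (intro sum.cong refl)
    fix i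
    have "(\<Sum>j\<in>?C. cnj (w i) * A i j * v j) = cnj (w i) * (\<Sum>j\<in>?C. A i j * v j)"
      by (simp add: sum_distrib_left mult.assoc)
    then show "(\<Sum>j\<in>?C. cnj (w i) * A i j * v j) = w i * cnj (w i)"
      by (simp add: w_def op_apply_def)
  qed
  \<comment> \<open>Hermiticity makes the second cross term the conjugate of the first, which is
    real.\<close>
  have "cnj ?P = (\<Sum>i\<in>?C. \<Sum>j\<in>?C. cnj (v j) * A j i * w i)"
    by (simp add: hermitian_opD[OF assms(1)] mult_ac)
  also have "\<dots> = ?Q"
    by (rule sum.swap)
  finally have Q: "?Q = of_real n"
    by (simp only: P complex_cnj_complex_of_real)
  have "0 \<le> 2 * t * (- n) + t\<^sup>2 * Re (qform d N A w)" for t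
  proof -
    have "qform d N A (\<lambda>i. v i - of_real t * w i) =
        qform d N A v - of_real t * (?P + ?Q) + of_real (t\<^sup>2) * qform d N A w"
      unfolding qform_def sum_distrib_left sum.distrib[symmetric] sum_subtractf[symmetric]
      by (intro sum.cong refl) (simp add: power2_eq_square algebra_simps)
    then have "Re (qform d N A (\<lambda>i. v i - of_real t * w i)) =
        Re (qform d N A v) - t * (n + n) + t\<^sup>2 * Re (qform d N A w)"
      unfolding P Q by (simp del: of_real_power)
    moreover have "0 \<le> Re (qform d N A (\<lambda>i. v i - of_real t * w i))"
      using assms(2) unfolding psd_op_qform by blast
    ultimately show ?thesis
      using assms(3) by simp
  qed
  then have "0 \<le> - n"
    by (rule nonneg_of_quadratic_nonneg)
  then have "(\<Sum>i\<in>?C. (cmod (w i))\<^sup>2) = 0"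
    unfolding n_def by (intro antisym sum_nonneg) simp_all
  then show ?thesis
    using assms(4) by (simp add: sum_nonneg_eq_0_iff w_def)
qed

section \<open>Near-optimal feasible Hamiltonians\<close>

lemma sum_cnj_self:
  assumes "normalized d N \<psi>"
  shows "(\<Sum>i\<in>cfg d (sites N). cnj (\<psi> i) * \<psi> i) = 1"
proof -
  have "(\<Sum>i\<in>cfg d (sites N). cnj (\<psi> i) * \<psi> i) =
      of_real (\<Sum>i\<in>cfg d (sites N). (cmod (\<psi> i))\<^sup>2)"
    unfolding of_real_sum by (simp add: complex_norm_square mult.commute del: of_real_power)
  then show ?thesis
    using assms by (simp add: normalized_def del: of_real_sum)
qed

lemma qform_proj_self:
  assumes "normalized d N \<psi>"
  shows "qform d N (proj \<psi>) \<psi> = 1"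
  by (simp add: qform_proj sum_cnj_self[OF assms])

text \<open>The form scales by a squared modulus and ignores values off the system. The vectors left
  to test are those whose projectors \<open>proj_in_bounded_densities\<close> covers.\<close>

lemma psd_opI_normalized:
  assumes "hermitian_op d (sites N) A"
    and "\<And>w. normalized d N w \<Longrightarrow> (\<And>i. i \<notin> cfg d (sites N) \<Longrightarrow> w i = 0)
      \<Longrightarrow> 0 \<le> Re (qform d N A w)"
  shows "psd_op d (sites N) A"
  unfolding psd_op_qform
proof (intro allI conjI qform_hermitian_real[OF assms(1)])
  fix v
  let ?C = "cfg d (sites N)"
  define n where "n = (\<Sum>i\<in>?C. (cmod (v i))\<^sup>2)"
  show "0 \<le> Re (qform d N A v)"
  proof (cases "n = 0")
    case True
    then have "v i = 0" if "i \<in> ?C" for i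
      using that by (simp add: n_def sum_nonneg_eq_0_iff)
    then show ?thesis by (simp add: qform_def)
  next
    case False
    moreover have "n \<ge> 0"
      unfolding n_def by (simp add: sum_nonneg)
    ultimately have "n > 0" by simp
    define w where "w i = (if i \<in> ?C then of_real (1 / sqrt n) * v i else 0)" for i
    have "(\<Sum>i\<in>?C. (cmod (w i))\<^sup>2) = (\<Sum>i\<in>?C. (cmod (v i))\<^sup>2 / n)"
      using \<open>n > 0\<close> by (simp add: w_def norm_mult norm_divide power_divide)
    also have "\<dots> = 1"
      using \<open>n > 0\<close> by (simp add: sum_divide_distrib[symmetric] n_def[symmetric])
    finally have "0 \<le> Re (qform d N A w)"
      by (intro assms(2)) (simp_all add: normalized_def w_def)
    moreover have "qform d N A v = qform d N A (\<lambda>i. of_real (sqrt n) * w i)"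
      using \<open>n > 0\<close> by (intro qform_cong) (simp add: w_def)
    ultimately show ?thesis
      using \<open>n > 0\<close> by (simp add: qform_scale_vec)
  qed
qed

lemma sdp_near_optimal:
  assumes nontriv: "nontrivial_nbhd N NS"
    and norm: "normalized d N \<psi>"
    and UDA: "UDA d N NS (proj \<psi>)"
    and "NS \<noteq> {}" and "\<epsilon> > 0"
  shows "\<exists>H. sdp_feasible d N NS (proj \<psi>) H \<and> sdp_objective d N (proj \<psi>) H = 1 - \<epsilon>"
proof -
  let ?C = "cfg d (sites N)" and ?D = "bounded_densities d N"
  define \<rho> where "\<rho> = proj \<psi>"
  \<comment> \<open>\<open>\<psi>\<close> may take arbitrary values off the system; this truncated
    copy of \<open>\<rho>\<close> lies in the compact set and has the same traces.\<close>
  define \<rho>0 where "\<rho>0 = proj (\<lambda>i. if i \<in> ?C then \<psi> i else 0)"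
  \<comment> \<open>\<open>E\<close> indexes all entries of all marginals. \<open>y\<close> and
    \<open>r\<close> are the deviations from the target in the marginals and in the overlap with
    \<open>\<rho>\<close>, and \<open>F\<close> is the squared distance.\<close>
  define E where "E = (SIGMA S:NS. cfg d S \<times> cfg d S)"
  define y where "y \<sigma> = (\<lambda>(S, i, j). ptrace d N S \<sigma> i j - ptrace d N S \<rho> i j)" for \<sigma>
  define r where "r \<sigma> = Re (trace_pair d N \<rho> \<sigma>) - 1 + \<epsilon>" for \<sigma>
  define F where "F \<sigma> = (\<Sum>e\<in>E. (cmod (y \<sigma> e))\<^sup>2) + (r \<sigma>)\<^sup>2" for \<sigma>
  have finNS: "finite NS" and subs: "\<And>S. S \<in> NS \<Longrightarrow> S \<subseteq> sites N"
    using nontriv by (auto simp: nontrivial_nbhd_def)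
  have fincfg: "finite (cfg d S)" if "S \<in> NS" for S
    using finite_subset[OF subs[OF that]] by (simp add: finite_cfg sites_def)
  have finE: "finite E"
    unfolding E_def using finNS fincfg by auto
  have sumE: "(\<Sum>e\<in>E. g e) = (\<Sum>S\<in>NS. \<Sum>i\<in>cfg d S. \<Sum>j\<in>cfg d S. g (S, i, j))"
    for g :: "nat set \<times> config \<times> config \<Rightarrow> complex"
    unfolding E_def using finNS fincfg
    by (subst sum.Sigma[symmetric, where g = "\<lambda>S p. g (S, p)", simplified])
      (auto simp: sum.cartesian_product)
  have \<rho>0D: "\<rho>0 \<in> ?D"
    unfolding \<rho>0_def using norm by (intro proj_in_bounded_densities) (auto simp: normalized_def)
  have \<rho>0_eq: "\<rho>0 i j = \<rho> i j" if "i \<in> ?C" "j \<in> ?C" for i j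
    using that by (simp add: \<rho>0_def \<rho>_def proj_def)
  have trace_cong: "trace_pair d N A \<sigma> = trace_pair d N A \<rho>"
    if "\<And>i j. i \<in> ?C \<Longrightarrow> j \<in> ?C \<Longrightarrow> \<sigma> i j = \<rho> i j" for A \<sigma>
    using that by (simp add: op_trace_def op_mult_def)
  have tr\<rho>: "trace_pair d N \<rho> \<rho> = 1"
    unfolding \<rho>_def trace_pair_proj using qform_proj_self[OF norm] .
  have "continuous_on ?D (\<lambda>\<sigma>. y \<sigma> e)" for e
    unfolding y_def ptrace_def by (cases e) (simp, intro continuous_intros)
  then have "continuous_on ?D F"
    unfolding F_def r_def op_trace_def op_mult_def by (intro continuous_intros)
  then obtain \<tau> where \<tau>: "\<tau> \<in> ?D" and min: "\<And>\<sigma>. \<sigma> \<in> ?D \<Longrightarrow> F \<tau> \<le> F \<sigma>"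
    using continuous_attains_inf[OF compact_bounded_densities, of d N F] \<rho>0D by blast
  \<comment> \<open>At distance zero the marginals agree, so UDA makes \<open>\<tau>\<close> equal
    to \<open>\<rho>\<close> on the system; but there the overlap misses its target by
    \<open>\<epsilon>\<close>.\<close>
  have "F \<tau> > 0"
  proof (rule ccontr)
    assume "\<not> F \<tau> > 0"
    moreover have "(\<Sum>e\<in>E. (cmod (y \<tau> e))\<^sup>2) \<ge> 0" "(r \<tau>)\<^sup>2 \<ge> 0"
      by (auto intro: sum_nonneg)
    ultimately have "(\<Sum>e\<in>E. (cmod (y \<tau> e))\<^sup>2) = 0" "(r \<tau>)\<^sup>2 = 0"
      unfolding F_def by linarith+
    then have "\<forall>e\<in>E. y \<tau> e = 0" and "r \<tau> = 0"
      using finE by (simp_all add: sum_nonneg_eq_0_iff)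
    then have "\<tau> i j = \<rho> i j" if "i \<in> ?C" "j \<in> ?C" for i j
      using UDA \<tau> that
      by (fastforce simp: UDA_def bounded_densities_def E_def y_def \<rho>_def)
    then have "r \<tau> = \<epsilon>"
      using trace_cong[of \<tau>] tr\<rho> by (simp add: r_def)
    with \<open>r \<tau> = 0\<close> \<open>\<epsilon> > 0\<close> show False by simp
  qed
  \<comment> \<open>The marginal part of the normal vector, read as one operator per neighborhood,
    so that \<open>K\<close> is quasi-local by construction.\<close>
  define X where "X S i j = y \<tau> (S, i, j)" for S i j
  define K where "K = (\<lambda>i j. \<Sum>S\<in>NS. embed N S (X S) i j)"
  have hermX: "hermitian_op d S (X S)" if "S \<in> NS" for S
  proof -
    have "hermitian_op d (sites N) \<tau>" "hermitian_op d (sites N) \<rho>"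
      using \<tau> density_proj[OF norm] by (auto simp: bounded_densities_def density_def \<rho>_def)
    then have "hermitian_op d S (ptrace d N S \<tau>)" "hermitian_op d S (ptrace d N S \<rho>)"
      using subs[OF that] by (auto intro: hermitian_ptrace)
    then show ?thesis
      by (subst hermitian_op_def) (simp add: X_def y_def hermitian_opD[of d S])
  qed
  \<comment> \<open>The trace pairing transposes one factor; hermiticity of \<open>X S\<close> turns
    it into the inner product with \<open>y \<tau>\<close>.\<close>
  have trK: "trace_pair d N K \<sigma> = (\<Sum>(S, i, j)\<in>E. cnj (X S i j) * ptrace d N S \<sigma> i j)" for \<sigma>
  proof -
    have "trace_pair d N (embed N S (X S)) \<sigma> =
        (\<Sum>i\<in>cfg d S. \<Sum>j\<in>cfg d S. cnj (X S i j) * ptrace d N S \<sigma> i j)" if "S \<in> NS" for S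
      unfolding trace_pair_embed[OF subs[OF that]]
      by (subst sum.swap) (simp add: hermitian_opD[OF hermX[OF that]])
    then show ?thesis
      by (simp add: K_def trace_pair_sum sumE)
  qed
  define \<kappa> where "\<kappa> = Re (trace_pair d N K \<rho>)"
  define c where "c = r \<tau>"
  \<comment> \<open>The separating hyperplane: first-order optimality of \<open>\<tau>\<close> along
    the segment to \<open>\<sigma>\<close>, which stays in the compact set by convexity.\<close>
  have key: "F \<tau> \<le> Re (trace_pair d N K \<sigma>) - \<kappa> + c * r \<sigma>" if "\<sigma> \<in> ?D" for \<sigma>
  proof -
    have "F \<tau> \<le> (\<Sum>e\<in>E. (cmod (of_real (1 - t) * y \<tau> e + of_real t * y \<sigma> e))\<^sup>2)
        + ((1 - t) * r \<tau> + t * r \<sigma>)\<^sup>2" if "0 < t" "t \<le> 1" for t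
    proof -
      have "y (mix t \<tau> \<sigma>) e = of_real (1 - t) * y \<tau> e + of_real t * y \<sigma> e" for e
        by (cases e) (simp add: y_def ptrace_mix algebra_simps)
      moreover have "r (mix t \<tau> \<sigma>) = (1 - t) * r \<tau> + t * r \<sigma>"
        by (simp add: r_def trace_pair_mix algebra_simps)
      ultimately show ?thesis
        using min[of "mix t \<tau> \<sigma>"] mix_in_bounded_densities[OF \<tau> \<open>\<sigma> \<in> ?D\<close>, of t] that
        by (simp add: F_def del: of_real_diff)
    qed
    then have "F \<tau> \<le> Re (\<Sum>e\<in>E. cnj (y \<tau> e) * y \<sigma> e) + r \<tau> * r \<sigma>"
      unfolding F_def by (rule nearest_point_first_order)
    moreover have "(\<Sum>e\<in>E. cnj (y \<tau> e) * y \<sigma> e) = trace_pair d N K \<sigma> - trace_pair d N K \<rho>"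
      unfolding trK sum_subtractf[symmetric]
      by (intro sum.cong refl) (auto simp: X_def y_def algebra_simps)
    ultimately show ?thesis
      by (simp add: \<kappa>_def c_def)
  qed
  \<comment> \<open>At \<open>\<rho>0\<close> the marginal part of \<open>key\<close> cancels,
    leaving \<open>0 < F \<tau> \<le> c * \<epsilon>\<close>. So the hyperplane is not vertical and
    one may divide by \<open>c\<close>.\<close>
  have "r \<rho>0 = \<epsilon>"
    using trace_cong[OF \<rho>0_eq] tr\<rho> by (simp add: r_def)
  then have "c * \<epsilon> > 0"
    using key[OF \<rho>0D] \<open>F \<tau> > 0\<close> trace_cong[OF \<rho>0_eq] by (simp add: \<kappa>_def)
  then have "c > 0"
    using \<open>\<epsilon> > 0\<close> by (simp add: zero_less_mult_iff)
  \<comment> \<open>Dividing by \<open>c\<close> gives the overlap with \<open>\<rho>\<close> weight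
    one. The shift makes the expectation of \<open>H + \<rho>\<close> in a state the right side of
    \<open>key\<close> over \<open>c\<close>; at \<open>\<rho>\<close> the \<open>K\<close> terms
    cancel, leaving objective \<open>1 - \<epsilon>\<close>.\<close>
  define H where "H = (\<lambda>i j. of_real (1 / c) * K i j
      + of_real (- (\<kappa> / c + 1 - \<epsilon>)) * (if i = j then 1 else 0))"
  obtain S where "S \<in> NS"
    using \<open>NS \<noteq> {}\<close> by blast
  then have ql: "quasi_local d N NS H"
    unfolding H_def K_def
    by (intro quasi_local_add quasi_local_scale quasi_local_sum_embed quasi_local_id
        hermX subs finNS)
  have trH: "Re (trace_pair d N H \<sigma>) = Re (trace_pair d N K \<sigma>) / c - (\<kappa> / c + 1 - \<epsilon>)"
    if "density d N \<sigma>" for \<sigma>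
    using that unfolding H_def trace_pair_add trace_pair_scale trace_pair_id density_def by simp
  have herm: "hermitian_op d (sites N) H"
    using ql by (simp add: quasi_local_def)
  have "psd_op d (sites N) (\<lambda>i j. H i j + \<rho> i j)"
  proof (rule psd_opI_normalized)
    show "hermitian_op d (sites N) (\<lambda>i j. H i j + \<rho> i j)"
      using hermitian_opD[OF herm]
      by (subst hermitian_op_def) (simp add: \<rho>_def proj_def)
    fix w
    assume w: "normalized d N w" "\<And>i. i \<notin> ?C \<Longrightarrow> w i = 0"
    then have D: "proj w \<in> ?D"
      by (rule proj_in_bounded_densities)
    have "Re (qform d N (\<lambda>i j. H i j + \<rho> i j) w) =
        (Re (trace_pair d N K (proj w)) - \<kappa> + c * r (proj w)) / c"
      using trH[OF density_proj[OF w(1)]] \<open>c > 0\<close>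
      by (simp add: qform_add trace_pair_proj r_def field_simps)
    also have "\<dots> \<ge> 0"
      using key[OF D] \<open>F \<tau> > 0\<close> \<open>c > 0\<close> by simp
    finally show "0 \<le> Re (qform d N (\<lambda>i j. H i j + \<rho> i j) w)" .
  qed
  moreover have "sdp_objective d N \<rho> H = 1 - \<epsilon>"
    using trH[OF density_proj[OF norm]] by (simp add: sdp_objective_def \<kappa>_def \<rho>_def)
  ultimately show ?thesis
    using ql herm unfolding sdp_feasible_def \<rho>_def by (intro exI[of _ H] conjI)
qed

section \<open>The optimal Hamiltonian\<close>

lemma qform_op_apply:
  "qform d N A v = (\<Sum>i\<in>cfg d (sites N). cnj (v i) * op_apply d N A v i)"
  by (simp add: qform_def op_apply_def sum_distrib_left mult.assoc)

lemma unique_ground_stateI: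
  assumes herm: "hermitian_op d (sites N) H"
    and psd: "psd_op d (sites N) (\<lambda>i j. H i j + proj \<psi> i j)"
    and norm: "normalized d N \<psi>"
    and opt: "Re (qform d N H \<psi>) \<le> - 1"
  shows "unique_ground_state d N H \<psi>"
proof -
  let ?C = "cfg d (sites N)"
  have herm': "hermitian_op d (sites N) (\<lambda>i j. H i j + proj \<psi> i j)"
    using hermitian_opD[OF herm] by (subst hermitian_op_def) (simp add: proj_def)
  have apply_\<psi>: "op_apply d N H \<psi> i = - \<psi> i" if "i \<in> ?C" for i
  proof -
    have "Re (qform d N (\<lambda>i j. H i j + proj \<psi> i j) \<psi>) \<le> 0"
      using opt by (simp add: qform_add qform_proj_self[OF norm])
    then have "op_apply d N (\<lambda>i j. H i j + proj \<psi> i j) \<psi> i = 0"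
      using psd_kernel[OF herm' psd _ that] by blast
    moreover have "op_apply d N (\<lambda>i j. H i j + proj \<psi> i j) \<psi> i =
        op_apply d N H \<psi> i + \<psi> i * (\<Sum>j\<in>?C. cnj (\<psi> j) * \<psi> j)"
      by (simp add: op_apply_def proj_def distrib_right sum.distrib sum_distrib_left mult.assoc)
    ultimately show ?thesis
      by (simp add: sum_cnj_self[OF norm] eq_neg_iff_add_eq_0)
  qed
  text \<open>Positivity of \<open>H + |\<psi>\<rangle>\<langle>\<psi>|\<close> at an eigenvector \<open>v\<close> bounds the squared norm of the
    component of \<open>v\<close> orthogonal to \<open>\<psi>\<close>.\<close>
  have eigen: "(\<Sum>i\<in>?C. (cmod (v i - (\<Sum>j\<in>?C. cnj (\<psi> j) * v j) * \<psi> i))\<^sup>2)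
      \<le> (Re \<mu> + 1) * (\<Sum>i\<in>?C. (cmod (v i))\<^sup>2)"
    if "\<forall>i\<in>?C. op_apply d N H v i = \<mu> * v i" for v \<mu>
  proof -
    define p where "p = (\<Sum>j\<in>?C. cnj (\<psi> j) * v j)"
    define n where "n = (\<Sum>i\<in>?C. (cmod (v i))\<^sup>2)"
    have n: "(\<Sum>i\<in>?C. cnj (v i) * v i) = of_real n"
      unfolding n_def of_real_sum complex_norm_square by (simp add: mult.commute)
    have p': "(\<Sum>j\<in>?C. \<psi> j * cnj (v j)) = cnj p"
      by (simp add: p_def)
    have "qform d N H v = \<mu> * of_real n"
      using that unfolding qform_op_apply n[symmetric] sum_distrib_left
      by (intro sum.cong refl) simp
    then have "0 \<le> Re \<mu> * n + (cmod p)\<^sup>2"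
      using psd unfolding psd_op_qform qform_add qform_proj p_def by (auto dest: spec[of _ v])
    \<comment> \<open>Pythagoras: removing the component along the unit vector \<open>\<psi>\<close>
      lowers the squared norm by \<open>(cmod p)\<^sup>2\<close>.\<close>
    moreover have "complex_of_real (\<Sum>i\<in>?C. (cmod (v i - p * \<psi> i))\<^sup>2) =
        (\<Sum>i\<in>?C. cnj (v i) * v i) - cnj p * (\<Sum>i\<in>?C. cnj (\<psi> i) * v i)
        - p * (\<Sum>i\<in>?C. \<psi> i * cnj (v i)) + p * cnj p * (\<Sum>i\<in>?C. cnj (\<psi> i) * \<psi> i)"
      unfolding of_real_sum complex_norm_square sum_distrib_left
        sum.distrib[symmetric] sum_subtractf[symmetric]
      by (intro sum.cong refl) (simp add: algebra_simps)
    then have "complex_of_real (\<Sum>i\<in>?C. (cmod (v i - p * \<psi> i))\<^sup>2) = of_real n - p * cnj p"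
      unfolding n p' p_def[symmetric] sum_cnj_self[OF norm] by (simp add: algebra_simps)
    then have "complex_of_real (\<Sum>i\<in>?C. (cmod (v i - p * \<psi> i))\<^sup>2) = of_real (n - (cmod p)\<^sup>2)"
      by (simp add: complex_norm_square del: of_real_power of_real_sum)
    then have "(\<Sum>i\<in>?C. (cmod (v i - p * \<psi> i))\<^sup>2) = n - (cmod p)\<^sup>2"
      by (simp only: of_real_eq_iff)
    ultimately show ?thesis
      unfolding p_def[symmetric] n_def[symmetric] by (simp add: algebra_simps)
  qed
  have ev: "eigenvalue_op d N H (- 1)"
  proof -
    have "\<exists>i\<in>?C. \<psi> i \<noteq> 0"
    proof (rule ccontr)
      assume "\<not> (\<exists>i\<in>?C. \<psi> i \<noteq> 0)"
      then show False
        using norm by (simp add: normalized_def)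
    qed
    then show ?thesis
      unfolding eigenvalue_op_def using apply_\<psi> by (intro exI[of _ \<psi>]) simp
  qed
  have lowest: "Re (- 1) \<le> Re \<mu>" if "eigenvalue_op d N H \<mu>" for \<mu>
  proof -
    from that obtain v
      where v: "\<exists>i\<in>?C. v i \<noteq> 0" "\<forall>i\<in>?C. op_apply d N H v i = \<mu> * v i"
      unfolding eigenvalue_op_def by (elim exE conjE)
    have "0 \<le> (\<Sum>i\<in>?C. (cmod (v i - (\<Sum>j\<in>?C. cnj (\<psi> j) * v j) * \<psi> i))\<^sup>2)"
      by (intro sum_nonneg) simp
    then have "0 \<le> (Re \<mu> + 1) * (\<Sum>i\<in>?C. (cmod (v i))\<^sup>2)"
      using eigen[OF v(2)] by linarith
    moreover have "0 < (\<Sum>i\<in>?C. (cmod (v i))\<^sup>2)"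
      using v(1) by (auto intro: sum_pos2)
    ultimately show ?thesis
      by (simp add: zero_le_mult_iff)
  qed
  \<comment> \<open>At eigenvalue \<open>- 1\<close> the bound \<open>eigen\<close> is zero, so
    \<open>v\<close> equals its component along \<open>\<psi>\<close>.\<close>
  have unique: "\<exists>c. \<forall>i\<in>?C. v i = c * \<psi> i"
    if "\<forall>i\<in>?C. op_apply d N H v i = - 1 * v i" for v
  proof -
    define p where "p = (\<Sum>j\<in>?C. cnj (\<psi> j) * v j)"
    have "(\<Sum>i\<in>?C. (cmod (v i - p * \<psi> i))\<^sup>2) \<le> 0"
      using eigen[OF that] by (simp add: p_def)
    then have "(\<Sum>i\<in>?C. (cmod (v i - p * \<psi> i))\<^sup>2) = 0"
      by (intro antisym sum_nonneg) simp_all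
    then show ?thesis
      by (intro exI[of _ p]) (simp add: sum_nonneg_eq_0_iff)
  qed
  have span: "op_apply d N H v i = - 1 * v i"
    if "\<forall>i\<in>?C. v i = c * \<psi> i" "i \<in> ?C" for v c i
  proof -
    have "op_apply d N H v i = c * op_apply d N H \<psi> i"
      using that by (simp add: op_apply_def sum_distrib_left mult_ac)
    then show ?thesis
      using that apply_\<psi> by simp
  qed
  show ?thesis
    unfolding unique_ground_state_def
    by (rule exI[of _ "- 1"], intro conjI allI impI iffI)
      (rule ev, erule lowest, erule unique, rule ballI, erule exE, erule span)
qed

text \<open>The space is one-dimensional and \<open>\<psi>\<close> is nonzero, so every vector is a
  multiple of \<open>\<psi>\<close> and lies in the kernel of the zero operator.\<close>

lemma unique_ground_state_no_sites:
  assumes "normalized d 0 \<psi>"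
  shows "unique_ground_state d 0 (\<lambda>_ _. 0) \<psi>"
proof -
  have C: "cfg d (sites 0) = {\<lambda>_. 0}"
    by (auto simp: cfg_def sites_def)
  then have "\<psi> (\<lambda>_. 0) \<noteq> 0"
    using assms by (auto simp: normalized_def)
  then show ?thesis
    unfolding unique_ground_state_def eigenvalue_op_def C
    by (intro exI[of _ 0])
      (auto simp: op_apply_def intro!: exI[of _ "_ / \<psi> (\<lambda>_. 0)"] exI[of _ \<psi>])
qed

theorem theoremV2:
  fixes d :: "nat \<Rightarrow> nat" and N :: nat and NS :: "nat set set" and \<psi> :: vec
  assumes "nontrivial_nbhd N NS"
    and "normalized d N \<psi>"
    and "UDA d N NS (proj \<psi>)"
    and "\<exists>H0. sdp_feasible d N NS (proj \<psi>) H0 \<and>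
           (\<forall>H. sdp_feasible d N NS (proj \<psi>) H \<longrightarrow>
                sdp_objective d N (proj \<psi>) H \<le> sdp_objective d N (proj \<psi>) H0)"
  shows "\<exists>H. quasi_local d N NS H \<and> unique_ground_state d N H \<psi>"
proof (cases "N = 0")
  case True
  \<comment> \<open>The empty set of sites has no proper subset.\<close>
  then have "NS = {}"
    using assms(1) by (auto simp: nontrivial_nbhd_def sites_def)
  then have "quasi_local d N NS (\<lambda>_ _. 0)"
    by (simp add: quasi_local_def hermitian_op_def)
  then show ?thesis
    using unique_ground_state_no_sites assms(2) True by blast
next
  case False
  \<comment> \<open>Some neighborhood must cover this site, and a single neighborhood makes the
    identity shift in \<open>sdp_near_optimal\<close> quasi-local.\<close>
  then have "1 \<in> sites N"
    by (simp add: sites_def)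
  then have "NS \<noteq> {}"
    using assms(1) by (auto simp: nontrivial_nbhd_def)
  obtain H0 where H0: "sdp_feasible d N NS (proj \<psi>) H0"
    and max: "\<And>H. sdp_feasible d N NS (proj \<psi>) H \<Longrightarrow>
      sdp_objective d N (proj \<psi>) H \<le> sdp_objective d N (proj \<psi>) H0"
    using assms(4) by blast
  \<comment> \<open>The feasible operators of \<open>sdp_near_optimal\<close> vary with
    \<open>\<epsilon>\<close>; attainment supplies one \<open>H0\<close> that dominates them all, so
    \<open>\<epsilon>\<close> can tend to zero.\<close>
  have near: "1 - \<epsilon> \<le> sdp_objective d N (proj \<psi>) H0" if "\<epsilon> > 0" for \<epsilon>
    using sdp_near_optimal[OF assms(1-3) \<open>NS \<noteq> {}\<close> that] max by metis
  have "1 \<le> sdp_objective d N (proj \<psi>) H0"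
  proof (rule field_le_epsilon)
    show "1 \<le> sdp_objective d N (proj \<psi>) H0 + \<epsilon>" if "\<epsilon> > 0" for \<epsilon>
      using near[OF that] by linarith
  qed
  then have "Re (qform d N H0 \<psi>) \<le> - 1"
    by (simp add: sdp_objective_def trace_pair_proj)
  then have "unique_ground_state d N H0 \<psi>"
    using H0 assms(2) by (intro unique_ground_stateI) (auto simp: sdp_feasible_def)
  then show ?thesis
    using H0 by (auto simp: sdp_feasible_def)
qed

end
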